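(* For $b>0$ let $\phi_b=\mathcal{D}_b h_1$ be the dilated first Hermite function, $\phi_b(t)=\frac{c_1}{\sqrt b}\,\frac{t}{b}\,e^{-\frac{\pi}{b^2}t^2}$, $t\in\mathbb{R}$, where $c_1\in\mathbb{C}\setminus\{0\}$, and let $$\delta_{\phi_b}(\omega)=\frac12\sqrt{\frac{\sum_{k\in\mathbb{Z}}|\widehat{\phi_b}(k+\omega)|^2}{\sum_{k\in\mathbb{Z}}(k+\omega)^2|\widehat{\phi_b}(k+\omega)|^2}}=\frac12\sqrt{\frac{\sum_{k\in\mathbb{Z}}(k+\omega)^2e^{-2\pi b^2(k+\omega)^2}}{\sum_{k\in\mathbb{Z}}(k+\omega)^4e^{-2\pi b^2(k+\omega)^2}}},\qquad \omega\in[0,1].$$ Then for every $b>0$, $$\min_{\omega\in[0,1]}\delta_{\phi_b}(\omega)\le\delta_{\phi_b}(0)<\frac12 .$$ Consequently, for all $a,b>0$ with $ab\ge \frac12$, the Wirtinger criterion for $\mathcal{G}(\phi_b,ab\,\mathbb{Z}\times\mathbb{Z})$ (equivalently, for the unitarily equivalent system $\mathcal{G}(h_1,a\mathbb{Z}\times b\mathbb{Z})$) is not satisfied, i.e. it is not true that $ab<\delta_{\phi_b}(\omega)$ for all $\omega\in[0,1]$.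
   Context: The first Hermite function is $h_1(t)=c_1\,t\,e^{-\pi t^2}$ with an arbitrary constant $c_1\in\mathbb{C}\setminus\{0\}$. The Fourier transform is $\widehat g(\omega)=\int_{\mathbb{R}}g(t)e^{-2\pi i\omega t}\,dt$. The unitary dilation operator is $\mathcal{D}_a f(t)=a^{-1/2}f(t/a)$, $a>0$. For $g\in L^2(\mathbb{R})$ and discrete $\Gamma\subset\mathbb{R}^2$, the Gabor system is $\mathcal{G}(g,\Gamma)=\{M_\omega T_x g\mid(x,\omega)\in\Gamma\}$, where $T_xf(t)=f(t-x)$ and $M_\omega f(t)=e^{2\pi i\omega t}f(t)$. The systems $\mathcal{G}(g,a\mathbb{Z}\times b\mathbb{Z})$ and $\mathcal{G}(\mathcal{D}_b g,ab\,\mathbb{Z}\times\mathbb{Z})$ are unitarily equivalent. The Wirtinger criterion is the following sufficient condition for $\mathcal{G}(g,\delta\mathbb{Z}\times\mathbb{Z})$, $\delta>0$, to be a frame for $L^2(\mathbb{R})$: $$\delta<\delta_g(\omega)=\frac12\sqrt{\frac{\sum_{k\in\mathbb{Z}}|\widehat g(k+\omega)|^2}{\sum_{k\in\mathbb{Z}}(k+\omega)^2|\widehat g(k+\omega)|^2}}\quad\text{for all }\omega\in[0,1].$$ *)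

theory Defs
  imports "HOL-Analysis.Analysis"
begin

definition fourier :: "(real \<Rightarrow> complex) \<Rightarrow> real \<Rightarrow> complex" where
  "fourier g \<omega> = (LINT t|lborel. g t * exp (- 2 * of_real pi * \<i> * of_real \<omega> * of_real t))"

definition translation :: "real \<Rightarrow> (real \<Rightarrow> complex) \<Rightarrow> real \<Rightarrow> complex" where
  "translation x f = (\<lambda>t. f (t - x))"

definition modulation :: "real \<Rightarrow> (real \<Rightarrow> complex) \<Rightarrow> real \<Rightarrow> complex" where
  "modulation \<omega> f = (\<lambda>t. exp (2 * of_real pi * \<i> * of_real \<omega> * of_real t) * f t)"

definition dilation :: "real \<Rightarrow> (real \<Rightarrow> complex) \<Rightarrow> real \<Rightarrow> complex" where
  "dilation a f = (\<lambda>t. of_real (a powr (- 1 / 2)) * f (t / a))"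

definition gabor_system :: "(real \<Rightarrow> complex) \<Rightarrow> (real \<times> real) set \<Rightarrow> (real \<Rightarrow> complex) set" where
  "gabor_system g \<Gamma> = {modulation \<omega> (translation x g) | x \<omega>. (x, \<omega>) \<in> \<Gamma>}"

definition rect_lattice :: "real \<Rightarrow> real \<Rightarrow> (real \<times> real) set" where
  "rect_lattice a b = {(a * of_int k, b * of_int l) | k l. True}"

definition hermite1 :: "complex \<Rightarrow> real \<Rightarrow> complex" where
  "hermite1 c = (\<lambda>t. c * of_real (t * exp (- pi * t\<^sup>2)))"

(* Elements of L^2(R) are handled through Borel representatives; equality of elements is
   equality almost everywhere. *)

definition square_integrable :: "(real \<Rightarrow> complex) set" where
  "square_integrable = {f. f \<in> borel_measurable lborel \<and> integrable lborel (\<lambda>t. (cmod (f t))\<^sup>2)}"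

definition l2_inner :: "(real \<Rightarrow> complex) \<Rightarrow> (real \<Rightarrow> complex) \<Rightarrow> complex" where
  "l2_inner f g = (LINT t|lborel. f t * cnj (g t))"

(* Compatibility with almost-everywhere equality follows from linearity together with
   preservation of the inner product. *)

definition l2_unitary :: "((real \<Rightarrow> complex) \<Rightarrow> real \<Rightarrow> complex) \<Rightarrow> bool" where
  "l2_unitary U \<longleftrightarrow>
     (\<forall>f\<in>square_integrable. U f \<in> square_integrable) \<and>
     (\<forall>f\<in>square_integrable. \<forall>g\<in>square_integrable. \<forall>z.
        AE t in lborel. U (\<lambda>s. z * f s + g s) t = z * U f t + U g t) \<and>
     (\<forall>f\<in>square_integrable. \<forall>g\<in>square_integrable. l2_inner (U f) (U g) = l2_inner f g) \<and>
     (\<forall>g\<in>square_integrable. \<exists>f\<in>square_integrable. AE t in lborel. U f t = g t)"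

definition unitarily_equivalent :: "(real \<Rightarrow> complex) set \<Rightarrow> (real \<Rightarrow> complex) set \<Rightarrow> bool" where
  "unitarily_equivalent S S' \<longleftrightarrow>
     S \<subseteq> square_integrable \<and> S' \<subseteq> square_integrable \<and>
     (\<exists>U. l2_unitary U \<and>
        (\<forall>f\<in>S. \<exists>g\<in>S'. AE t in lborel. U f t = g t) \<and>
        (\<forall>g\<in>S'. \<exists>f\<in>S. AE t in lborel. U f t = g t))"

definition wirtinger_delta :: "(real \<Rightarrow> complex) \<Rightarrow> real \<Rightarrow> real" where
  "wirtinger_delta g \<omega> = 1 / 2 * sqrt
     ((\<Sum>\<^sub>\<infinity>k\<in>(UNIV::int set). (cmod (fourier g (of_int k + \<omega>)))\<^sup>2) /
      (\<Sum>\<^sub>\<infinity>k\<in>(UNIV::int set). (of_int k + \<omega>)\<^sup>2 * (cmod (fourier g (of_int k + \<omega>)))\<^sup>2))"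

(* The criterion for the system gabor_system g (rect_lattice \<delta> 1). *)

definition wirtinger_criterion :: "(real \<Rightarrow> complex) \<Rightarrow> real \<Rightarrow> bool" where
  "wirtinger_criterion g \<delta> \<longleftrightarrow> (\<forall>\<omega>\<in>{0..1}. \<delta> < wirtinger_delta g \<omega>)"

(* The criterion for gabor_system g (rect_lattice a b), for a, b > 0: it is applied to the
   unitarily equivalent system gabor_system (dilation b g) (rect_lattice (a * b) 1). *)

definition wirtinger_criterion_rect :: "(real \<Rightarrow> complex) \<Rightarrow> real \<Rightarrow> real \<Rightarrow> bool" where
  "wirtinger_criterion_rect g a b \<longleftrightarrow> wirtinger_criterion (dilation b g) (a * b)"

end

(* The Fourier transform of t exp(-pi t^2) is -i w exp(-pi w^2): integrating the derivative of
   exp(-x^2/2) exp(isx) over the line reduces it to the transform of the Gaussian. Hence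
   delta(w)^2 is, up to the factor 1/4, the quotient of the sums of (k+w)^2 E and (k+w)^4 E,
   where E = exp(-2 pi b^2 (k+w)^2). At w = 0 the nodes are integers, so k^2 <= k^4 with strict
   inequality at k = 2, and the quotient is below 1. The minimum exists by locally uniform
   convergence of both sums, and the unitary equivalence is implemented by the dilation itself. *)

theory Submission
  imports Defs "HOL-Probability.Characteristic_Functions" "HOL-Real_Asymp.Real_Asymp"
begin

section \<open>Dilations as unitary equivalences of Gabor systems\<close>

lemma dilation_modulation_translation:
  assumes "b > 0"
  shows "dilation b (modulation \<omega> (translation x g))
       = modulation (\<omega> / b) (translation (b * x) (dilation b g))"
  using assms
  by (auto simp: dilation_def modulation_def translation_def fun_eq_iff field_simps)

lemma dilation_inverse:
  assumes "b > 0"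
  shows "dilation b (dilation (1 / b) g) = g"
proof -
  have "b powr (- 1 / 2) * (1 / b) powr (- 1 / 2) = 1"
    using assms by (simp add: powr_mult[symmetric])
  then have "complex_of_real (b powr (- 1 / 2)) * complex_of_real ((1 / b) powr (- 1 / 2)) = 1"
    by (metis of_real_1 of_real_mult)
  then show ?thesis
    using assms by (auto simp: dilation_def fun_eq_iff mult.assoc[symmetric])
qed

lemma powr_neg_half_square:
  fixes b :: real
  assumes "b > 0"
  shows "(b powr (- 1 / 2))\<^sup>2 = 1 / b"
proof -
  have "(b powr (- 1 / 2))\<^sup>2 = b powr (-1)"
    by (simp add: power2_eq_square powr_add[symmetric])
  then show ?thesis using assms by (simp add: powr_minus_divide)
qed

lemma l2_inner_dilation:
  assumes "b > 0"
  shows "l2_inner (dilation b f) (dilation b g) = l2_inner f g"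
proof -
  have *: "complex_of_real (b powr (- 1 / 2)) * complex_of_real (b powr (- 1 / 2))
      = complex_of_real (1 / b)"
    using powr_neg_half_square[OF assms] by (metis of_real_mult power2_eq_square)
  have "l2_inner (dilation b f) (dilation b g)
      = (LINT t|lborel. complex_of_real (1 / b) * (f (t / b) * cnj (g (t / b))))"
    unfolding l2_inner_def dilation_def *[symmetric]
    by (intro Bochner_Integration.integral_cong) (auto simp: algebra_simps)
  \<comment> \<open>Substituting t = b s brings the Jacobian b, which cancels the squared
    normalization 1/b.\<close>
  also have "\<dots> = b *\<^sub>R (LINT t|lborel. complex_of_real (1 / b) * (f t * cnj (g t)))"
    using assms by (subst lborel_integral_real_affine[where c = b and t = 0]) auto
  also have "\<dots> = l2_inner f g"
    using assms by (simp add: l2_inner_def scaleR_conv_of_real)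
  finally show ?thesis .
qed

lemma square_integrable_dilation:
  assumes "b > 0" and "g \<in> square_integrable"
  shows "dilation b g \<in> square_integrable"
proof -
  have [measurable]: "g \<in> borel_measurable borel"
    and int: "integrable lborel (\<lambda>t. (cmod (g t))\<^sup>2)"
    using assms by (auto simp: square_integrable_def)
  have "integrable lborel (\<lambda>t. (cmod (g (t / b)))\<^sup>2)"
    using lborel_integrable_real_affine[OF int, of "1 / b" 0] assms by simp
  then show ?thesis
    by (auto simp: square_integrable_def dilation_def norm_mult power_mult_distrib)
qed

lemma square_integrable_modulation_translation:
  assumes "g \<in> square_integrable"
  shows "modulation \<omega> (translation x g) \<in> square_integrable"
proof -
  have [measurable]: "g \<in> borel_measurable borel"
    and int: "integrable lborel (\<lambda>t. (cmod (g t))\<^sup>2)"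
    using assms by (auto simp: square_integrable_def)
  have "integrable lborel (\<lambda>t. (cmod (g (t - x)))\<^sup>2)"
    using lborel_integrable_real_affine[OF int, of 1 "- x"] by simp
  moreover have "(\<lambda>t. exp (2 * complex_of_real pi * \<i> * complex_of_real \<omega> * complex_of_real t))
      \<in> borel_measurable borel"
    by (intro borel_measurable_continuous_onI continuous_intros)
  ultimately show ?thesis
    by (auto simp: square_integrable_def modulation_def translation_def norm_mult power_mult_distrib)
qed

lemma l2_unitary_dilation:
  assumes "b > 0"
  shows "l2_unitary (dilation b)"
  unfolding l2_unitary_def
proof (intro conjI ballI allI)
  fix f g :: "real \<Rightarrow> complex" and z
  show "AE t in lborel. dilation b (\<lambda>s. z * f s + g s) t = z * dilation b f t + dilation b g t"
    by (simp add: dilation_def algebra_simps)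
next
  fix g :: "real \<Rightarrow> complex"
  assume "g \<in> square_integrable"
  then show "\<exists>f\<in>square_integrable. AE t in lborel. dilation b f t = g t"
    using assms
    by (intro bexI[of _ "dilation (1 / b) g"])
       (simp_all add: dilation_inverse square_integrable_dilation)
qed (use assms in \<open>simp_all add: square_integrable_dilation l2_inner_dilation\<close>)

text \<open>Parametrizing every rectangular lattice by the same pairs of integers lets two Gabor
  systems be compared index by index.\<close>

lemma gabor_system_rect_lattice:
  "gabor_system g (rect_lattice a b)
     = (\<lambda>(k, l). modulation (b * of_int l) (translation (a * of_int k) g)) ` UNIV"
  by (auto simp: gabor_system_def rect_lattice_def image_iff split_paired_Ex)

text \<open>Commuting the dilation past a time-frequency shift multiplies the time by b and divides
  the frequency by b, so the node (a k, b l) moves to (a b k, l) with the same index.\<close>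

lemma gabor_system_dilation:
  assumes "b > 0"
  shows "gabor_system (dilation b g) (rect_lattice (a * b) 1)
       = dilation b ` gabor_system g (rect_lattice a b)"
  unfolding gabor_system_rect_lattice image_image
  using assms
  by (intro image_cong)
     (auto simp: dilation_modulation_translation algebra_simps split: prod.splits)

lemma gabor_system_subset_square_integrable:
  assumes "g \<in> square_integrable"
  shows "gabor_system g \<Gamma> \<subseteq> square_integrable"
  using assms by (auto simp: gabor_system_def square_integrable_modulation_translation)

lemma unitarily_equivalent_gabor_dilation:
  assumes "g \<in> square_integrable" and "b > 0"
  shows "unitarily_equivalent (gabor_system g (rect_lattice a b))
           (gabor_system (dilation b g) (rect_lattice (a * b) 1))"
  unfolding unitarily_equivalent_def
proof (intro conjI exI[of _ "dilation b"] ballI)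
  show "gabor_system (dilation b g) (rect_lattice (a * b) 1) \<subseteq> square_integrable"
    using assms by (intro gabor_system_subset_square_integrable square_integrable_dilation)
qed (use assms in \<open>auto simp: gabor_system_dilation l2_unitary_dilation
       dest: gabor_system_subset_square_integrable intro!: AE_I2\<close>)

section \<open>Fourier transform and square integrability of the first Hermite function\<close>

lemma fourier_dilation:
  assumes "b > 0"
  shows "fourier (dilation b g) \<omega> = of_real (sqrt b) * fourier g (b * \<omega>)"
proof -
  have s: "b powr (- 1 / 2) * b = sqrt b"
    using assms powr_add[of b "- 1 / 2" 1] by (simp add: powr_half_sqrt)
  have "fourier (dilation b g) \<omega> = b *\<^sub>R (LINT t|lborel. of_real (b powr (- 1 / 2)) *
      (g t * exp (- 2 * of_real pi * \<i> * of_real (b * \<omega>) * of_real t)))"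
    unfolding fourier_def dilation_def
    using assms
    by (subst lborel_integral_real_affine[where c = b and t = 0]) (auto simp: algebra_simps)
  also have "\<dots> = of_real (b powr (- 1 / 2) * b) * fourier g (b * \<omega>)"
    by (simp add: fourier_def scaleR_conv_of_real)
  finally show ?thesis unfolding s .
qed

text \<open>Kills the boundary terms when the derivative of the density times
  \<open>iexp (s * x)\<close> is integrated over the line.\<close>

lemma std_normal_density_at_infinity: "(std_normal_density \<longlongrightarrow> 0) at_infinity"
proof -
  have "((\<lambda>x. exp (- (x\<^sup>2) / 2)) \<longlongrightarrow> 0) (at_infinity :: real filter)"
    unfolding at_infinity_eq_at_top_bot by (rule filterlim_sup; real_asymp)
  then have "((\<lambda>x. 1 / sqrt (2 * pi) * exp (- (x\<^sup>2) / 2)) \<longlongrightarrow> 0) (at_infinity :: real filter)"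
    by (rule tendsto_mult_right_zero)
  then show ?thesis unfolding std_normal_density_def by simp
qed

text \<open>The oscillating factor has modulus one, so the moments of the density dominate. The
  cases k = 0 and k = 1 are the ones used.\<close>

lemma integrable_std_normal_moment_iexp:
  "integrable lborel (\<lambda>x. complex_of_real (std_normal_density x * x ^ k) * iexp (s * x))"
proof (rule Bochner_Integration.integrable_bound[OF integrable_std_normal_moment[of k]])
  show "AE x in lborel. norm (complex_of_real (std_normal_density x * x ^ k) * iexp (s * x))
      \<le> norm (std_normal_density x * x ^ k)"
    unfolding norm_mult norm_exp_i_times norm_of_real by (simp add: abs_mult)
qed measurable

lemma integral_std_normal_first_moment_iexp:
  "(LINT x|lborel. complex_of_real (std_normal_density x * x) * iexp (s * x))
     = \<i> * of_real s * of_real (exp (- s\<^sup>2 / 2))"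
proof -
  define F where "F = (\<lambda>x. complex_of_real (std_normal_density x) * iexp (s * x))"
  define G where "G = (\<lambda>x. complex_of_real (std_normal_density x * x) * iexp (s * x))"
  have int: "integrable lborel F" "integrable lborel G"
    using integrable_std_normal_moment_iexp[of 0 s] integrable_std_normal_moment_iexp[of 1 s]
    by (simp_all add: F_def G_def)
  have deriv: "(F has_vector_derivative (\<i> * s * F x - G x)) (at x)" for x
  proof -
    have "(std_normal_density has_real_derivative (- x * std_normal_density x)) (at x)"
    proof -
      have "((\<lambda>x. exp (- x\<^sup>2 / 2)) has_real_derivative (- x * exp (- x\<^sup>2 / 2))) (at x)"
        by (auto intro!: derivative_eq_intros)
      from DERIV_cmult[OF this, of "1 / sqrt (2 * pi)"] show ?thesis
        by (simp add: std_normal_density_def[abs_def] mult_ac)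
    qed
    then have d1: "((\<lambda>x. complex_of_real (std_normal_density x)) has_vector_derivative
        of_real (- x * std_normal_density x)) (at x)"
      by (intro has_vector_derivative_of_real)
         (simp add: has_real_derivative_iff_has_vector_derivative)
    \<comment> \<open>The exponential is differentiated in a complex variable and then restricted to
      the real line.\<close>
    have "((\<lambda>z. exp (\<i> * of_real s * z)) has_field_derivative
        \<i> * of_real s * exp (\<i> * of_real s * of_real x)) (at (of_real x))"
      by (auto intro!: derivative_eq_intros)
    from has_vector_derivative_real_field[OF this]
    have d2: "((\<lambda>x. iexp (s * x)) has_vector_derivative \<i> * s * iexp (s * x)) (at x)"
      by (simp add: mult.assoc)
    show ?thesis
      unfolding F_def G_def
      by (rule has_vector_derivative_eq_rhs[OF has_vector_derivative_mult[OF d1 d2]])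
         (simp add: algebra_simps)
  qed
  have cont: "isCont (\<lambda>x. \<i> * s * F x - G x) x" for x
    unfolding F_def G_def std_normal_density_def by (intro continuous_intros) auto
  have lim: "(F \<longlongrightarrow> 0) at_infinity"
    by (rule tendsto_norm_zero_cancel)
       (use tendsto_norm_zero[OF std_normal_density_at_infinity] in
        \<open>simp add: F_def norm_mult del: of_real_mult\<close>)
  have "(LBINT x=-\<infinity>..\<infinity>. \<i> * s * F x - G x) = 0 - 0"
  proof (rule interval_integral_FTC_integrable[where F = F])
    show "set_integrable lborel (einterval (- \<infinity>) \<infinity>) (\<lambda>x. \<i> * s * F x - G x)"
      using int by (simp add: set_integrable_def)
    show "((F \<circ> real_of_ereal) \<longlongrightarrow> 0) (at_right (- \<infinity>))"
      and "((F \<circ> real_of_ereal) \<longlongrightarrow> 0) (at_left \<infinity>)"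
      using lim unfolding ereal_tendsto_simps
      by (auto intro: tendsto_mono[OF at_top_le_at_infinity] tendsto_mono[OF at_bot_le_at_infinity])
  qed (use deriv cont in auto)
  then have "(LINT x|lborel. \<i> * s * F x - G x) = 0"
    by (simp add: interval_lebesgue_integral_def set_lebesgue_integral_def)
  then have "(LINT x|lborel. G x) = \<i> * s * (LINT x|lborel. F x)"
    using int by simp
  \<comment> \<open>The remaining integral is the characteristic function of the standard normal
    law, whose value exp(-s^2/2) is known.\<close>
  also have "(LINT x|lborel. F x) = char std_normal_distribution s"
    unfolding char_def F_def
    by (subst integral_density) (auto simp: scaleR_conv_of_real normal_density_nonneg)
  finally show ?thesis
    by (simp add: G_def char_std_normal_distribution)
qed

text \<open>The scaling turns exp(-pi t^2) into exp(-x^2/2), and the 1/sqrt(2 pi) coming from the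
  linear factor is exactly the normalization of the density, so no constant is left over.\<close>

lemma hermite1_scaled:
  "hermite1 c (x / sqrt (2 * pi)) = c * of_real (std_normal_density x * x)"
proof -
  have "- pi * (x / sqrt (2 * pi))\<^sup>2 = - x\<^sup>2 / 2"
    by (simp add: power_divide)
  then have "x / sqrt (2 * pi) * exp (- pi * (x / sqrt (2 * pi))\<^sup>2) = std_normal_density x * x"
    by (simp only: std_normal_density_def) simp
  then show ?thesis by (simp only: hermite1_def)
qed

lemma fourier_hermite1:
  "fourier (hermite1 c) \<omega> = - \<i> * c * of_real (\<omega> * exp (- pi * \<omega>\<^sup>2))"
proof -
  \<comment> \<open>With t = x / r the phase -2 pi \<omega> t becomes s x for s = -r \<omega>, since
    r^2 = 2 pi. The Jacobian 1/r later cancels the factor r in s.\<close>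
  define r where "r = sqrt (2 * pi)"
  have r: "r > 0" "r * r = 2 * pi" by (auto simp: r_def)
  have ex: "- 2 * complex_of_real pi * \<i> * of_real \<omega> * of_real (x / r) = \<i> * of_real (- r * \<omega> * x)" for x
  proof -
    have "2 * pi * \<omega> * (x / r) = r * \<omega> * x" using r by (simp add: field_simps)
    have "- 2 * complex_of_real pi * \<i> * of_real \<omega> * of_real (x / r)
       = - (\<i> * of_real (2 * pi * \<omega> * (x / r)))" by simp
    also have "\<dots> = \<i> * of_real (- r * \<omega> * x)"
      unfolding \<open>2 * pi * \<omega> * (x / r) = r * \<omega> * x\<close> by simp
    finally show ?thesis .
  qed
  have "fourier (hermite1 c) \<omega> = (1 / r) *\<^sub>R
      (LINT x|lborel. c * (of_real (std_normal_density x * x) * iexp (- r * \<omega> * x)))"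
    unfolding fourier_def
    using r hermite1_scaled[of c, folded r_def] ex
    by (subst lborel_integral_real_affine[where c = "1 / r" and t = 0])
       (auto simp: mult.assoc)
  also have "\<dots> = (1 / r) *\<^sub>R (c * (\<i> * of_real (- r * \<omega>) * of_real (exp (- (- r * \<omega>)\<^sup>2 / 2))))"
    by (simp only: integral_mult_right_zero integral_std_normal_first_moment_iexp)
  also have "- (- r * \<omega>)\<^sup>2 / 2 = - pi * \<omega>\<^sup>2"
    using r by (simp add: power2_eq_square)
  finally show ?thesis
    using r by (simp add: scaleR_conv_of_real)
qed

lemma square_integrable_hermite1: "hermite1 c \<in> square_integrable"
proof -
  have meas: "hermite1 c \<in> borel_measurable borel"
    unfolding hermite1_def by measurable
  define K where "K = (cmod c)\<^sup>2 / sqrt (2 * pi)"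
  have bound: "norm ((cmod (hermite1 c (x / sqrt (2 * pi))))\<^sup>2) \<le> K * (std_normal_density x * x ^ 2)" for x
  proof -
    \<comment> \<open>One of the two density factors is replaced by its maximum 1/sqrt(2 pi); what
      remains is the integrand of the second normal moment.\<close>
    have "(std_normal_density x)\<^sup>2 \<le> 1 / sqrt (2 * pi) * std_normal_density x"
      unfolding power2_eq_square
      by (intro mult_right_mono) (auto simp: std_normal_density_def divide_right_mono)
    then have "(cmod c)\<^sup>2 * x\<^sup>2 * (std_normal_density x)\<^sup>2
        \<le> (cmod c)\<^sup>2 * x\<^sup>2 * (1 / sqrt (2 * pi) * std_normal_density x)"
      by (intro mult_left_mono) auto
    then show ?thesis
      unfolding hermite1_scaled K_def
      by (simp add: norm_mult power_mult_distrib mult_ac)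
  qed
  have "integrable lborel (\<lambda>x. (cmod (hermite1 c (x / sqrt (2 * pi))))\<^sup>2)"
  proof (rule Bochner_Integration.integrable_bound)
    show "integrable lborel (\<lambda>x. K * (std_normal_density x * x ^ 2))"
      by (intro integrable_mult_right integrable_std_normal_moment)
    show "AE x in lborel. norm ((cmod (hermite1 c (x / sqrt (2 * pi))))\<^sup>2)
        \<le> norm (K * (std_normal_density x * x ^ 2))"
      using bound by (intro AE_I2 order.trans[OF bound]) simp
  qed (use meas in measurable)
  then have "integrable lborel (\<lambda>x. (cmod (hermite1 c x))\<^sup>2)"
    using lborel_integrable_real_affine_iff[of "1 / sqrt (2 * pi)" "\<lambda>x. (cmod (hermite1 c x))\<^sup>2" 0]
    by simp
  then show ?thesis using meas by (simp add: square_integrable_def)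
qed

section \<open>Gaussian moment sums over shifted integers\<close>

lemma summable_on_int_inverse_square:
  "(\<lambda>k::int. 1 / (1 + (real_of_int k)\<^sup>2)) summable_on UNIV"
proof -
  have nat: "(\<lambda>n::nat. 1 / (1 + (real n)\<^sup>2)) summable_on UNIV"
  proof (rule norm_summable_imp_summable_on, rule summable_comparison_test)
    \<comment> \<open>The comparison starts at 1: at n = 0 the right side is
      \<open>inverse 0\<close>, which is 0.\<close>
    show "\<exists>N. \<forall>n\<ge>N. norm (norm (1 / (1 + (real n)\<^sup>2))) \<le> inverse (real n ^ 2)"
      by (intro exI[of _ 1] allI impI) (auto simp: field_simps abs_of_pos add_pos_nonneg)
    show "summable (\<lambda>n. inverse (real n ^ 2))"
      by (rule inverse_power_summable) simp
  qed
  have pos: "(\<lambda>k::int. 1 / (1 + (real_of_int k)\<^sup>2)) summable_on range int"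
    by (subst summable_on_reindex) (use nat in \<open>auto simp: o_def\<close>)
  have neg: "(\<lambda>k::int. 1 / (1 + (real_of_int k)\<^sup>2)) summable_on range (\<lambda>n. - int n)"
    by (subst summable_on_reindex) (use nat in \<open>auto simp: o_def inj_def\<close>)
  have "(UNIV :: int set) = range int \<union> range (\<lambda>n. - int n)"
    by (auto simp: image_iff) (metis int_cases2)
  then show ?thesis
    using summable_on_union[OF pos neg] by simp
qed

text \<open>For c = 2 pi b^2 the values n = 1 and n = 2 give, up to a common constant, the terms of
  the numerator and denominator of the Wirtinger quotient. The even exponent keeps all terms
  nonnegative, and multiplying by x^2 raises n by one.\<close>

definition gauss_moment :: "nat \<Rightarrow> real \<Rightarrow> real \<Rightarrow> real" where
  "gauss_moment n c x = x ^ (2 * n) * exp (- c * x\<^sup>2)"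

lemma gauss_moment_nonneg: "gauss_moment n c x \<ge> 0"
  by (simp add: gauss_moment_def)

text \<open>For y = c x^2 the quotient y^n / n! is a single term of the nonnegative series for
  exp(y).\<close>

lemma gauss_moment_bounded:
  assumes "c > 0"
  shows "gauss_moment n c x \<le> fact n / c ^ n"
proof -
  have "(c * x\<^sup>2) ^ n / fact n \<le> exp (c * x\<^sup>2)"
    using sum_le_suminf[OF summable_exp_generic[of "c * x\<^sup>2"], of "{n}"] assms
    by (simp add: exp_def divide_inverse mult.commute)
  then have "c ^ n * x ^ (2 * n) \<le> fact n * exp (c * x\<^sup>2)"
    unfolding power_mult power_mult_distrib by (simp add: pos_divide_le_eq mult.commute)
  then show ?thesis
    using assms by (simp add: gauss_moment_def exp_minus field_simps)
qed

text \<open>Multiplication by 1 + x^2 gives the sum of the moments of order n and n + 1, both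
  bounded; passing from x = k + \<omega> to k costs a factor 3. The bound does not depend on
  \<omega>, so it serves both for summability and as a Weierstrass majorant.\<close>

lemma gauss_moment_shift_le:
  assumes "c > 0" "\<bar>\<omega>\<bar> \<le> 1"
  shows "gauss_moment n c (of_int k + \<omega>)
     \<le> 3 * (fact n / c ^ n + fact (Suc n) / c ^ Suc n) * (1 / (1 + (real_of_int k)\<^sup>2))"
proof -
  define x where "x = real_of_int k + \<omega>"
  define C where "C = (fact n / c ^ n + fact (Suc n) / c ^ Suc n :: real)"
  have "gauss_moment n c x * (1 + x\<^sup>2) = gauss_moment n c x + gauss_moment (Suc n) c x"
    by (simp add: gauss_moment_def algebra_simps power2_eq_square)
  also have "\<dots> \<le> C"
    unfolding C_def by (intro add_mono gauss_moment_bounded assms)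
  finally have 1: "gauss_moment n c x * (1 + x\<^sup>2) \<le> C" .
  have "\<omega>\<^sup>2 \<le> 1" using assms by (simp add: abs_square_le_1)
  \<comment> \<open>Parallelogram identity for k = x - \<omega>. With \<omega>^2 \<le> 1 it yields 1
    + k^2 \<le> 3 + 2 x^2, whence the factor 3.\<close>
  moreover have "(real_of_int k)\<^sup>2 = 2 * x\<^sup>2 + 2 * \<omega>\<^sup>2 - (x + \<omega>)\<^sup>2"
    by (simp add: x_def power2_eq_square algebra_simps)
  then have "(real_of_int k)\<^sup>2 \<le> 2 * x\<^sup>2 + 2 * \<omega>\<^sup>2"
    by simp
  ultimately have "1 + (real_of_int k)\<^sup>2 \<le> 3 * (1 + x\<^sup>2)"
    using zero_le_power2[of x] unfolding distrib_left by linarith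
  then have "gauss_moment n c x * (1 + (real_of_int k)\<^sup>2) \<le> gauss_moment n c x * (3 * (1 + x\<^sup>2))"
    by (intro mult_left_mono gauss_moment_nonneg)
  also have "\<dots> \<le> 3 * C" using 1 by (subst mult.left_commute) simp
  finally show ?thesis
    by (simp add: x_def C_def pos_le_divide_eq add_pos_nonneg)
qed

definition gauss_moment_sum :: "nat \<Rightarrow> real \<Rightarrow> real \<Rightarrow> real" where
  "gauss_moment_sum n c \<omega> = (\<Sum>\<^sub>\<infinity>k\<in>(UNIV::int set). gauss_moment n c (of_int k + \<omega>))"

lemma summable_gauss_moment:
  assumes "c > 0" "\<bar>\<omega>\<bar> \<le> 1"
  shows "(\<lambda>k::int. gauss_moment n c (of_int k + \<omega>)) summable_on UNIV"
  by (rule summable_on_comparison_test[OF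
        summable_on_cmult_right[OF summable_on_int_inverse_square]
        gauss_moment_shift_le[OF assms]])
     (rule gauss_moment_nonneg)

lemma continuous_on_gauss_moment_sum:
  assumes "c > 0"
  shows "continuous_on {0..1} (gauss_moment_sum n c)"
  unfolding gauss_moment_sum_def
\<comment> \<open>Partial sums over finite sets of integers are continuous and converge uniformly on
  the unit interval.\<close>
proof (rule uniform_limit_theorem[OF _ Weierstrass_m_test_general])
  show "norm (gauss_moment n c (of_int k + \<omega>))
      \<le> 3 * (fact n / c ^ n + fact (Suc n) / c ^ Suc n) * (1 / (1 + (real_of_int k)\<^sup>2))"
    if "\<omega> \<in> {0..1}" for k \<omega>
    using gauss_moment_shift_le[OF assms, of \<omega> n k] gauss_moment_nonneg[of n c "of_int k + \<omega>"] that
    by simp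
  show "\<forall>\<^sub>F X in finite_subsets_at_top UNIV.
      continuous_on {0..1} (\<lambda>\<omega>. \<Sum>k\<in>X. gauss_moment n c (of_int k + \<omega>))"
    unfolding gauss_moment_def by (intro always_eventually allI continuous_intros)
qed (rule summable_on_cmult_right[OF summable_on_int_inverse_square], simp)

lemma gauss_moment_sum_pos:
  assumes "c > 0" "\<bar>\<omega>\<bar> \<le> 1"
  shows "gauss_moment_sum n c \<omega> > 0"
proof -
  \<comment> \<open>For n > 0 a node at the origin contributes nothing, so a nonzero node is chosen;
    k = 0 or k = 1 provides one.\<close>
  obtain k :: int where k: "of_int k + \<omega> \<noteq> 0"
    by (metis add.commute add_cancel_right_left add_left_cancel of_int_1 of_int_0 zero_neq_one)
  have "0 < gauss_moment n c (of_int k + \<omega>)"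
    using k by (simp add: gauss_moment_def zero_less_mult_iff zero_less_power_eq)
  also have "\<dots> = (\<Sum>\<^sub>\<infinity>j\<in>{k}. gauss_moment n c (of_int j + \<omega>))"
    by simp
  also have "\<dots> \<le> gauss_moment_sum n c \<omega>"
    unfolding gauss_moment_sum_def
    by (rule infsum_mono2) (auto simp: summable_gauss_moment assms gauss_moment_nonneg)
  finally show ?thesis .
qed

lemma gauss_moment_sum_0_less:
  assumes "c > 0"
  shows "gauss_moment_sum 1 c 0 < gauss_moment_sum 2 c 0"
proof -
  have s: "(\<lambda>k::int. gauss_moment n c (of_int k)) summable_on UNIV" for n
    using summable_gauss_moment[OF assms, of 0 n] by simp
  have le: "gauss_moment 1 c (of_int k) \<le> gauss_moment 2 c (of_int k)" for k :: int
  proof -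
    have "(real_of_int k)\<^sup>2 \<le> (real_of_int k) ^ 4"
    proof (cases "k = 0")
      case False
      then have "1 \<le> \<bar>real_of_int k\<bar>" by linarith
      then have "\<bar>real_of_int k\<bar> ^ 2 \<le> \<bar>real_of_int k\<bar> ^ 4" by (intro power_increasing) auto
      then show ?thesis by (simp add: power_even_abs)
    qed simp
    then show ?thesis by (simp add: gauss_moment_def)
  qed
  have "gauss_moment_sum 1 c 0 \<noteq> gauss_moment_sum 2 c 0"
  proof
    \<comment> \<open>Termwise comparison yields only a weak inequality of the sums. If they were
      equal, the nonnegative differences would sum to zero and hence all vanish.\<close>
    define d where "d k = gauss_moment 2 c (of_int k) - gauss_moment 1 c (of_int k)" for k :: int
    have d: "d summable_on UNIV"
      by (rule summable_on_comparison_test[OF s[of 2]])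
         (use le in \<open>auto simp: d_def gauss_moment_nonneg\<close>)
    assume "gauss_moment_sum 1 c 0 = gauss_moment_sum 2 c 0"
    moreover have "gauss_moment_sum 2 c 0 = gauss_moment_sum 1 c 0 + (\<Sum>\<^sub>\<infinity>k. d k)"
      using infsum_add[OF s[of 1] d] by (simp add: gauss_moment_sum_def d_def[abs_def])
    ultimately have "(\<Sum>\<^sub>\<infinity>k. d k) = 0"
      by simp
    moreover have "d k \<ge> 0" for k
      using le by (simp add: d_def)
    \<comment> \<open>The differences do vanish at 0, 1 and -1; at 2 the difference is (16 - 4)
      exp(-4 c) > 0.\<close>
    ultimately have "d 2 = 0"
      using nonneg_infsum_le_0D[of d UNIV 2] d by simp
    then show False by (simp add: d_def gauss_moment_def)
  qed
  moreover have "gauss_moment_sum 1 c 0 \<le> gauss_moment_sum 2 c 0"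
    unfolding gauss_moment_sum_def using s le by (intro infsum_mono) auto
  ultimately show ?thesis by simp
qed

section \<open>The Wirtinger bound of the dilated Hermite function\<close>

lemma wirtinger_delta_dilation_hermite1:
  assumes "c \<noteq> 0" "b > 0"
  shows "wirtinger_delta (dilation b (hermite1 c)) \<omega> = 1 / 2 * sqrt
    (gauss_moment_sum 1 (2 * pi * b\<^sup>2) \<omega> / gauss_moment_sum 2 (2 * pi * b\<^sup>2) \<omega>)"
proof -
  \<comment> \<open>One factor b is the square of the sqrt(b) from the dilated transform, and b^2
    comes from (b x)^2. Being nonzero, K cancels in the quotient.\<close>
  define K where "K = (cmod c)\<^sup>2 * b ^ 3"
  have K: "K > 0" using assms by (simp add: K_def)
  have f: "(cmod (fourier (dilation b (hermite1 c)) x))\<^sup>2 = K * gauss_moment 1 (2 * pi * b\<^sup>2) x" for x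
  proof -
    have "(exp (- (pi * (b * x)\<^sup>2)))\<^sup>2 = exp (- (2 * pi * b\<^sup>2 * x\<^sup>2))"
      by (simp add: power2_eq_square exp_add[symmetric])
    then show ?thesis
      using assms
      by (simp add: fourier_dilation fourier_hermite1 norm_mult power_mult_distrib K_def
          gauss_moment_def power3_eq_cube power2_eq_square[of b])
  qed
  have f2: "x\<^sup>2 * (cmod (fourier (dilation b (hermite1 c)) x))\<^sup>2 = K * gauss_moment 2 (2 * pi * b\<^sup>2) x" for x
    unfolding f by (simp add: gauss_moment_def power2_eq_square numeral_eq_Suc)
  show ?thesis
    \<comment> \<open>The weighted denominator is rewritten first, because \<open>f\<close> would
      destroy the pattern of \<open>f2\<close>.\<close>
    unfolding wirtinger_delta_def f2 unfolding f infsum_cmult_right' gauss_moment_sum_def using K by simp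
qed

lemma wirtinger_delta_dilation_hermite1_attains_min:
  assumes "c \<noteq> 0" "b > 0"
  shows "\<exists>\<omega>\<^sub>0. is_arg_min (wirtinger_delta (dilation b (hermite1 c))) (\<lambda>\<omega>. \<omega> \<in> {0..1}) \<omega>\<^sub>0"
proof -
  let ?\<delta> = "wirtinger_delta (dilation b (hermite1 c))"
  have "2 * pi * b\<^sup>2 > 0" using assms by simp
  note p = gauss_moment_sum_pos[OF this] and ct = continuous_on_gauss_moment_sum[OF this]
  have "continuous_on {0..1} ?\<delta>"
    unfolding wirtinger_delta_dilation_hermite1[OF assms]
    \<comment> \<open>Positivity of the second moment sum keeps the denominator away from
      zero.\<close>
    using p[of _ 2] by (intro continuous_intros ct ballI less_imp_neq[symmetric] p) auto
  then obtain \<omega>\<^sub>0 where "\<omega>\<^sub>0 \<in> {0..1}" "\<forall>\<omega>\<in>{0..1}. ?\<delta> \<omega>\<^sub>0 \<le> ?\<delta> \<omega>"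
    using continuous_attains_inf[of "{0..1}" ?\<delta>] by auto
  then show ?thesis
    by (auto simp: is_arg_min_linorder)
qed

lemma wirtinger_delta_dilation_hermite1_0_less:
  assumes "c \<noteq> 0" "b > 0"
  shows "wirtinger_delta (dilation b (hermite1 c)) 0 < 1 / 2"
proof -
  have c: "2 * pi * b\<^sup>2 > 0" using assms by simp
  show ?thesis
    unfolding wirtinger_delta_dilation_hermite1[OF assms]
    using gauss_moment_sum_0_less[OF c] gauss_moment_sum_pos[OF c, of 0 2] by simp
qed

theorem mainTheorem1:
  fixes c1 :: complex and \<phi> :: "real \<Rightarrow> real \<Rightarrow> complex"
  assumes "c1 \<noteq> 0"
  defines "\<phi> \<equiv> (\<lambda>b. dilation b (hermite1 c1))"
  shows
    "(\<forall>b>0.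
        (\<forall>t. \<phi> b t = c1 / of_real (sqrt b) * of_real (t / b) * of_real (exp (- (pi / b\<^sup>2) * t\<^sup>2))) \<and>
        (\<forall>\<omega>\<in>{0..1}. wirtinger_delta (\<phi> b) \<omega> = 1 / 2 * sqrt
           ((\<Sum>\<^sub>\<infinity>k\<in>(UNIV::int set). (of_int k + \<omega>)\<^sup>2 * exp (- 2 * pi * b\<^sup>2 * (of_int k + \<omega>)\<^sup>2)) /
            (\<Sum>\<^sub>\<infinity>k\<in>(UNIV::int set). (of_int k + \<omega>) ^ 4 * exp (- 2 * pi * b\<^sup>2 * (of_int k + \<omega>)\<^sup>2)))) \<and>
        (\<exists>\<omega>\<^sub>0. is_arg_min (wirtinger_delta (\<phi> b)) (\<lambda>\<omega>. \<omega> \<in> {0..1}) \<omega>\<^sub>0 \<and>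
               wirtinger_delta (\<phi> b) \<omega>\<^sub>0 \<le> wirtinger_delta (\<phi> b) 0) \<and>
        wirtinger_delta (\<phi> b) 0 < 1 / 2)
     \<and> (\<forall>a>0. \<forall>b>0.
        unitarily_equivalent (gabor_system (hermite1 c1) (rect_lattice a b))
                             (gabor_system (\<phi> b) (rect_lattice (a * b) 1)))
     \<and> (\<forall>a>0. \<forall>b>0. a * b \<ge> 1 / 2 \<longrightarrow>
        \<not> wirtinger_criterion (\<phi> b) (a * b) \<and>
        \<not> wirtinger_criterion_rect (hermite1 c1) a b)"
proof -
  note c1 = assms(1)
  have formula: "\<phi> b t = c1 / of_real (sqrt b) * of_real (t / b) * of_real (exp (- (pi / b\<^sup>2) * t\<^sup>2))"
    if "b > 0" for b t
    using that powr_minus_divide[of b "1 / 2"]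
    by (simp add: \<phi>_def dilation_def hermite1_def powr_half_sqrt power_divide)
  have delta: "wirtinger_delta (\<phi> b) \<omega> = 1 / 2 * sqrt
      ((\<Sum>\<^sub>\<infinity>k\<in>(UNIV::int set). (of_int k + \<omega>)\<^sup>2 * exp (- 2 * pi * b\<^sup>2 * (of_int k + \<omega>)\<^sup>2)) /
       (\<Sum>\<^sub>\<infinity>k\<in>(UNIV::int set). (of_int k + \<omega>) ^ 4 * exp (- 2 * pi * b\<^sup>2 * (of_int k + \<omega>)\<^sup>2)))"
    if "b > 0" for b \<omega>
    unfolding \<phi>_def wirtinger_delta_dilation_hermite1[OF c1 that]
    by (simp add: gauss_moment_sum_def gauss_moment_def)
  have less: "wirtinger_delta (\<phi> b) 0 < 1 / 2" if "b > 0" for b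
    unfolding \<phi>_def by (rule wirtinger_delta_dilation_hermite1_0_less[OF c1 that])
  have arg_min: "\<exists>\<omega>\<^sub>0. is_arg_min (wirtinger_delta (\<phi> b)) (\<lambda>\<omega>. \<omega> \<in> {0..1}) \<omega>\<^sub>0 \<and>
      wirtinger_delta (\<phi> b) \<omega>\<^sub>0 \<le> wirtinger_delta (\<phi> b) 0" if "b > 0" for b
    using wirtinger_delta_dilation_hermite1_attains_min[OF c1 that]
    by (auto simp: \<phi>_def is_arg_min_linorder)
  \<comment> \<open>The criterion already fails at \<omega> = 0, where the bound is below 1/2 \<le>
    a b.\<close>
  have "\<not> wirtinger_criterion (\<phi> b) (a * b)" if "b > 0" "a * b \<ge> 1 / 2" for a b
    using less[OF that(1)] that(2) by (auto simp: wirtinger_criterion_def intro!: bexI[of _ 0])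
  moreover from this have "\<not> wirtinger_criterion_rect (hermite1 c1) a b"
    if "b > 0" "a * b \<ge> 1 / 2" for a b
    using that by (auto simp: wirtinger_criterion_rect_def \<phi>_def)
  moreover have "unitarily_equivalent (gabor_system (hermite1 c1) (rect_lattice a b))
      (gabor_system (\<phi> b) (rect_lattice (a * b) 1))" if "b > 0" for a b
    unfolding \<phi>_def by (intro unitarily_equivalent_gabor_dilation square_integrable_hermite1 that)
  ultimately show ?thesis
    using formula delta arg_min less by blast
qed

end
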